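(* The generating function $\sum_{n\geq0} d_n x^n$, where $d_n$ is the number of $132$-avoiding Dumont permutations of length $n$, equals $(1+x)C(x^2)$. Equivalently, for every $n\geq 0$ the number of $132$-avoiding Dumont permutations in $S_n$ equals the Catalan number $C_{\lfloor n/2\rfloor}$.
   Context: A permutation $\pi=\pi_1\cdots\pi_n\in S_n$ is a Dumont permutation (of the first kind) if every even entry $\pi_i$ is followed by a smaller entry ($i<n$ and $\pi_{i+1}<\pi_i$) and every odd entry $\pi_i$ is either last ($i=n$) or followed by a larger entry ($\pi_{i+1}>\pi_i$); the empty permutation is a Dumont permutation. $\pi$ avoids $132$ if there are no $i<j<l$ with $\pi_i<\pi_l<\pi_j$. $C_m=\frac{1}{m+1}\binom{2m}{m}$ is the $m$th Catalan number and $C(x)=\sum_{m\geq0}C_mx^m=\frac{1-\sqrt{1-4x}}{2x}$. *)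

theory Defs
  imports
    "HOL-Combinatorics.Multiset_Permutations"
    "HOL-Computational_Algebra.Formal_Power_Series"
begin

text \<open>
  A permutation in \<open>S\<^sub>n\<close> is given in one-line notation, as an element of
  \<^term>\<open>permutations_of_set {1..n::nat}\<close>. List positions are counted from 0, so the
  entry \<open>\<pi>\<^sub>i\<close> is \<open>xs ! (i - 1)\<close>.
\<close>

definition dumont :: "nat list \<Rightarrow> bool" where
  "dumont xs \<longleftrightarrow>
     (\<forall>i<length xs.
        (even (xs ! i) \<longrightarrow> Suc i < length xs \<and> xs ! Suc i < xs ! i) \<and>
        (odd (xs ! i) \<longrightarrow> Suc i = length xs \<or> xs ! Suc i > xs ! i))"

definition avoids_132 :: "nat list \<Rightarrow> bool" where
  "avoids_132 xs \<longleftrightarrow>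
     \<not> (\<exists>i j l. i < j \<and> j < l \<and> l < length xs \<and> xs ! i < xs ! l \<and> xs ! l < xs ! j)"

definition dumont_132 :: "nat \<Rightarrow> nat list set" where
  "dumont_132 n = {xs \<in> permutations_of_set {1..n}. dumont xs \<and> avoids_132 xs}"

definition catalan :: "nat \<Rightarrow> real" where
  "catalan m = 1 / (real m + 1) * real ((2 * m) choose m)"

definition catalan_fps :: "real fps" where
  "catalan_fps = Abs_fps catalan"

end

theory Submission
  imports Defs
begin

text \<open>
  Split a 132-avoiding permutation at its maximum: \<open>\<pi> = L n R\<close>, where every entry of \<open>L\<close>
  exceeds every entry of \<open>R\<close>. If \<open>\<pi>\<close> is Dumont, so are \<open>L\<close> and \<open>R\<close>. For odd \<open>n\<close> the block
  \<open>R\<close> is empty. For even \<open>n\<close> it is nonempty, and since the least entry of a nonempty Dumont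
  word is odd (it is followed by nothing smaller), either \<open>L\<close> is empty or \<open>R\<close> has even length.
  Hence \<open>d (2 k + 1) = d (2 k)\<close>, and \<open>d (2 k)\<close> satisfies the Catalan recurrence. The latter
  holds for the closed form \<open>catalan\<close> by the Vandermonde identity for \<open>1/2 + 1/2 = 1\<close>.
\<close>

section \<open>The Catalan recurrence\<close>

text \<open>Two absorption identities reduce the central binomial coefficient to the previous one.
  The ratio found here is what gets compared with that of the binomials of
  \<open>1/2\<close>.\<close>

lemma catalan_Suc: "catalan (Suc m) = 2 * (2 * real m + 1) / (real m + 2) * catalan m"
proof -
  have "Suc m * (2 * Suc m choose Suc m) = 2 * Suc m * (Suc (2 * m) choose m)"
    using Suc_times_binomial_eq[of "Suc (2 * m)" m] by (simp add: mult.commute)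
  then have 1: "(2 * Suc m choose Suc m) = 2 * (Suc (2 * m) choose m)"
    by (metis (no_types, lifting) Suc_mult_cancel1 mult.assoc mult.commute)
  have "(Suc (2 * m) - m) * (Suc (2 * m) choose m) = Suc (2 * m) * (2 * m choose m)"
    using binomial_absorb_comp[of "Suc (2 * m)" m] by simp
  then have 2: "(real m + 1) * real (Suc (2 * m) choose m) = (2 * real m + 1) * real (2 * m choose m)"
    by (metis (no_types, lifting) Suc_diff_le add_diff_cancel_right' le_add2 mult_2 of_nat_Suc
        of_nat_mult of_nat_numeral add.commute)
  have 3: "real (Suc (2 * m) choose m) = (2 * real m + 1) / (real m + 1) * real (2 * m choose m)"
    using 2 by (simp add: field_simps)
  show ?thesis
    unfolding catalan_def 1 of_nat_mult 3 by (simp add: add.commute)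
qed

text \<open>These are the coefficients of (1 - sqrt(1 - 4x)) / (2x) under the binomial series. Both
  sides start at 1 and have the same ratio of consecutive terms.\<close>

lemma catalan_eq_gbinomial: "catalan m = 2 * (-4) ^ m * ((1/2 :: real) gchoose Suc m)"
proof (induction m)
  case 0
  show ?case by (simp add: catalan_def)
next
  case (Suc m)
  \<comment> \<open>The ratio of consecutive binomials: (1/2 - (m + 1)) / (m + 2).\<close>
  define c where "c = - (2 * real m + 1) / (2 * (real m + 2))"
  have eq: "((1/2 :: real) gchoose Suc (Suc m)) = c * ((1/2) gchoose Suc m)"
    using gbinomial_mult_1[of "1/2 :: real" "Suc m"] by (simp add: c_def field_simps)
  have "2 * (2 * real m + 1) / (real m + 2) = -4 * c"
    by (simp add: c_def field_simps)
  then show ?case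
    by (simp add: catalan_Suc Suc.IH eq)
qed

lemma catalan_convolution: "catalan (Suc m) = (\<Sum>j\<le>m. catalan (m - j) * catalan j)"
proof -
  define g where "g = (\<lambda>k. (1/2 :: real) gchoose k)"
  \<comment> \<open>The top entry 1 is a natural number below m + 2, so the Vandermonde sum
    vanishes.\<close>
  have "0 = (1 :: real) gchoose Suc (Suc m)"
    by (metis One_nat_def Suc_less_SucD binomial_eq_0 binomial_gbinomial less_Suc_eq_0_disj
        of_nat_0 of_nat_1 zero_less_Suc Suc_less_eq)
  also have "\<dots> = (\<Sum>k\<le>Suc (Suc m). g k * g (Suc (Suc m) - k))"
    using gbinomial_Vandermonde[of "1/2 :: real" "1/2" "Suc (Suc m)"] by (simp add: g_def atMost_atLeast0)
  \<comment> \<open>The two end terms both equal \<open>g (Suc (Suc m))\<close>, because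
    \<open>g 0 = 1\<close>; the inner ones are reindexed by k = j + 1.\<close>
  also have "\<dots> = 2 * g (Suc (Suc m)) + (\<Sum>j\<le>m. g (Suc j) * g (Suc m - j))"
    by (subst sum.atMost_Suc, subst sum.atMost_Suc_shift) (simp add: g_def)
  finally have *: "(\<Sum>j\<le>m. g (Suc j) * g (Suc m - j)) = - 2 * g (Suc (Suc m))"
    by simp
  have "(\<Sum>j\<le>m. catalan (m - j) * catalan j) =
      (\<Sum>j\<le>m. 4 * (-4) ^ m * (g (Suc j) * g (Suc m - j)))"
  proof (rule sum.cong)
    fix j assume "j \<in> {..m}"
    then have "(-4 :: real) ^ m = (-4) ^ (m - j) * (-4) ^ j" and "Suc m - j = Suc (m - j)"
      by (simp_all flip: power_add)
    then show "catalan (m - j) * catalan j = 4 * (-4) ^ m * (g (Suc j) * g (Suc m - j))"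
      by (simp add: catalan_eq_gbinomial g_def)
  qed simp
  also have "\<dots> = 4 * (-4) ^ m * (- 2 * g (Suc (Suc m)))"
    by (simp only: * flip: sum_distrib_left)
  also have "\<dots> = catalan (Suc m)"
    by (simp add: catalan_eq_gbinomial g_def)
  finally show ?thesis ..
qed

section \<open>Splitting at the maximum\<close>

lemma dumont_Nil: "dumont []"
  by (simp add: dumont_def)

lemma dumont_singleton: "dumont [x] \<longleftrightarrow> odd x"
  by (simp add: dumont_def)

lemma dumont_Cons_Cons:
  "dumont (x # y # zs) \<longleftrightarrow> (if even x then y < x else x < y) \<and> dumont (y # zs)"
  unfolding dumont_def by (auto simp: All_less_Suc2)

text \<open>Only the junction could matter. Being last and being followed by a larger entry allow
  the same parity, odd, so the last entry of \<open>xs\<close> obeys the same condition in both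
  words.\<close>

lemma dumont_append_greater:
  assumes "\<forall>x\<in>set xs. x < y"
  shows "dumont (xs @ y # ys) \<longleftrightarrow> dumont xs \<and> dumont (y # ys)"
  using assms
proof (induction xs rule: induct_list012)
  case 1
  then show ?case by (simp add: dumont_Nil)
next
  case (2 x)
  then show ?case by (auto simp: dumont_Cons_Cons dumont_singleton)
next
  case (3 x x' xs)
  then show ?case by (auto simp: dumont_Cons_Cons)
qed

lemma dumont_Cons_greater:
  assumes "\<forall>x\<in>set ys. x < y"
  shows "dumont (y # ys) \<longleftrightarrow> (if even y then ys \<noteq> [] \<and> dumont ys else ys = [])"
  using assms by (cases ys) (auto simp: dumont_Cons_Cons dumont_singleton)

lemma dumont_least_odd:
  assumes "dumont xs" "x \<in> set xs" "\<forall>y\<in>set xs. x \<le> y"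
  shows "odd x"
proof
  assume "even x"
  obtain i where "i < length xs" "xs ! i = x"
    using assms(2) by (auto simp: in_set_conv_nth)
  with assms(1) \<open>even x\<close> have "Suc i < length xs" "xs ! Suc i < x"
    by (auto simp: dumont_def)
  with assms(3) show False
    by (metis not_le nth_mem)
qed

text \<open>An even shift preserves both parity and order.\<close>

lemma dumont_map_add:
  assumes "even r"
  shows "dumont (map ((+) r) xs) \<longleftrightarrow> dumont xs"
  using assms
  by (induction xs rule: induct_list012) (auto simp: dumont_Nil dumont_singleton dumont_Cons_Cons)

section \<open>Avoidance of 132 under splitting\<close>

lemma avoids_132_Nil: "avoids_132 []"
  by (simp add: avoids_132_def)

text \<open>An occurrence using the head must use it as the 1; the \<open>sorted_wrt\<close>
  condition forbids a later pair \<open>c\<close>, \<open>b\<close> acting as 3 and 2. This form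
  suits list induction.\<close>

lemma avoids_132_Cons:
  "avoids_132 (x # xs) \<longleftrightarrow> avoids_132 xs \<and> sorted_wrt (\<lambda>c b. \<not> (x < b \<and> b < c)) xs"
proof -
  have "avoids_132 (x # xs) \<longleftrightarrow> (\<forall>i j l. i < j \<longrightarrow> j < l \<longrightarrow> l < Suc (length xs) \<longrightarrow>
      \<not> ((x # xs) ! i < (x # xs) ! l \<and> (x # xs) ! l < (x # xs) ! j))"
    unfolding avoids_132_def by auto
  also have "\<dots> \<longleftrightarrow> avoids_132 xs \<and> sorted_wrt (\<lambda>c b. \<not> (x < b \<and> b < c)) xs" (is "?A \<longleftrightarrow> ?B")
  proof
    assume A: ?A
    have "avoids_132 xs"
      unfolding avoids_132_def
    proof (intro notI, elim exE conjE)
      fix i j l assume "i < j" "j < l" "l < length xs" "xs ! i < xs ! l" "xs ! l < xs ! j"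
      then show False using A[rule_format, of "Suc i" "Suc j" "Suc l"] by simp
    qed
    moreover have "\<not> (x < xs ! l \<and> xs ! l < xs ! j)" if "j < l" "l < length xs" for j l
      using A[rule_format, of 0 "Suc j" "Suc l"] that by simp
    ultimately show ?B by (simp add: sorted_wrt_iff_nth_less)
  next
    assume B: ?B
    show ?A
    proof (intro allI impI)
      fix i j l assume ijl: "i < j" "j < l" "l < Suc (length xs)"
      then obtain j' l' where jl: "j = Suc j'" "l = Suc l'"
        by (metis less_imp_Suc_add)
      show "\<not> ((x # xs) ! i < (x # xs) ! l \<and> (x # xs) ! l < (x # xs) ! j)"
        using B ijl jl by (cases i) (auto simp: avoids_132_def sorted_wrt_iff_nth_less)
    qed
  qed
  finally show ?thesis .
qed

lemma sorted_wrt_not_between: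
  fixes x :: nat
  assumes "\<forall>b\<in>set ys. b \<le> x"
  shows "sorted_wrt (\<lambda>c b. \<not> (x < b \<and> b < c)) ys"
  using assms by (induction ys) auto

text \<open>With \<open>y\<close> as the 3, any a < b across the split would be an occurrence.
  Conversely, if \<open>b \<le> a\<close> always holds across it, no entry of \<open>xs\<close> can
  be the 1 for a 2 in \<open>ys\<close>, so no occurrence straddles the split.\<close>

lemma avoids_132_append_greater:
  assumes "\<forall>x\<in>set xs. x < y" "\<forall>x\<in>set ys. x < y"
  shows "avoids_132 (xs @ y # ys) \<longleftrightarrow>
    avoids_132 xs \<and> avoids_132 ys \<and> (\<forall>a\<in>set xs. \<forall>b\<in>set ys. b \<le> a)"
  using assms
proof (induction xs)
  case Nil
  have "sorted_wrt (\<lambda>c b. \<not> (y < b \<and> b < c)) ys"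
    using Nil by (intro sorted_wrt_not_between) auto
  then show ?case by (simp add: avoids_132_Nil avoids_132_Cons)
next
  case (Cons x xs)
  have "sorted_wrt (\<lambda>c b. \<not> (x < b \<and> b < c)) (xs @ y # ys) \<longleftrightarrow>
      sorted_wrt (\<lambda>c b. \<not> (x < b \<and> b < c)) xs \<and> (\<forall>b\<in>set ys. b \<le> x)"
    using Cons.prems sorted_wrt_not_between[of ys x]
    by (fastforce simp: sorted_wrt_append not_less)
  then show ?case
    using Cons by (auto simp: avoids_132_Cons)
qed

lemma avoids_132_map_add: "avoids_132 (map ((+) r) xs) \<longleftrightarrow> avoids_132 xs"
  unfolding avoids_132_def by auto

section \<open>Counting\<close>

text \<open>\<open>B\<close> is closed downwards in \<open>{1..m}\<close>: an element of
  \<open>A\<close> would lie above \<open>Max B\<close>.\<close>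

lemma interval_split_below:
  fixes A B :: "nat set"
  assumes "A \<union> B = {1..m}" "\<And>a b. a \<in> A \<Longrightarrow> b \<in> B \<Longrightarrow> b < a"
  shows "B = {1..card B}" "A = {Suc (card B)..m}"
proof -
  have fin: "finite B" using assms(1) by (metis finite_Un finite_atLeastAtMost)
  have "B = {1..card B}"
  proof (cases "B = {}")
    case False
    have "B = {1..Max B}"
    proof
      show "B \<subseteq> {1..Max B}" using assms(1) fin by auto
      have "Max B \<in> B" using fin False by simp
      show "{1..Max B} \<subseteq> B"
      proof
        fix x assume x: "x \<in> {1..Max B}"
        have "x \<in> {1..m}" using x \<open>Max B \<in> B\<close> assms(1) by (metis UnCI atLeastAtMost_iff le_trans)
        then show "x \<in> B"
          using assms x \<open>Max B \<in> B\<close> by (metis Un_iff atLeastAtMost_iff not_le)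
      qed
    qed
    then show ?thesis by (metis card_atLeastAtMost diff_Suc_1)
  qed simp
  have "A \<inter> B = {}" using assms(2) by blast
  then have "A = {1..m} - B" using assms(1) by blast
  moreover have "{1..m} - {1..card B} = {Suc (card B)..m}" by auto
  ultimately show "A = {Suc (card B)..m}" using \<open>B = {1..card B}\<close> by metis
  show "B = {1..card B}" by fact
qed

section \<open>Composing and decomposing at the maximum\<close>

lemma mem_dumont_132:
  "xs \<in> dumont_132 n \<longleftrightarrow> set xs = {1..n} \<and> distinct xs \<and> dumont xs \<and> avoids_132 xs"
  by (auto simp: dumont_132_def permutations_of_set_def)

lemma finite_dumont_132: "finite (dumont_132 n)"
  by (simp add: dumont_132_def)

lemma length_dumont_132: "xs \<in> dumont_132 n \<Longrightarrow> length xs = n"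
  by (metis card_atLeastAtMost diff_Suc_1 distinct_card mem_dumont_132)

lemma dumont_132_0: "dumont_132 0 = {[]}"
  by (auto simp: mem_dumont_132 dumont_Nil avoids_132_Nil)

text \<open>Here \<open>r\<close> is the length of the right block. The condition \<open>r\<close>
  lets the left block be shifted without changing parity, or makes it empty; the condition
  \<open>n\<close> says that the right block is nonempty exactly when the maximum
  \<open>Suc n\<close> is even.\<close>

lemma map_add_append_in_dumont_132:
  assumes xs: "xs \<in> dumont_132 (n - r)" and ys: "ys \<in> dumont_132 r" and "r \<le> n"
    and r: "even r \<or> r = n" and n: "odd n \<longleftrightarrow> r > 0"
  shows "map ((+) r) xs @ Suc n # ys \<in> dumont_132 (Suc n)"
proof -
  have set_xs: "set (map ((+) r) xs) = {Suc r..n}"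
    using xs \<open>r \<le> n\<close> by (simp add: mem_dumont_132 image_add_atLeastAtMost)
  have set_ys: "set ys = {1..r}" using ys by (simp add: mem_dumont_132)
  have "dumont (map ((+) r) xs)"
    using r
  proof
    assume "even r"
    then show ?thesis using xs by (simp add: dumont_map_add mem_dumont_132)
  next
    assume "r = n"
    then show ?thesis using xs by (simp add: dumont_132_0 dumont_Nil)
  qed
  moreover have "dumont (Suc n # ys)"
    using n ys set_ys \<open>r \<le> n\<close> by (subst dumont_Cons_greater) (auto simp: mem_dumont_132)
  ultimately have "dumont (map ((+) r) xs @ Suc n # ys)"
    using set_xs by (subst dumont_append_greater) auto
  moreover have "avoids_132 (map ((+) r) xs @ Suc n # ys)"
    using xs ys set_xs set_ys \<open>r \<le> n\<close>
    by (subst avoids_132_append_greater) (auto simp: mem_dumont_132 avoids_132_map_add)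
  moreover have "set (map ((+) r) xs @ Suc n # ys) = {1..Suc n}"
    unfolding set_append set_xs list.set set_ys using \<open>r \<le> n\<close> by auto
  moreover have "distinct (map ((+) r) xs @ Suc n # ys)"
    using xs ys \<open>r \<le> n\<close> unfolding distinct_append set_xs list.set distinct.simps set_ys
    by (auto simp: mem_dumont_132 distinct_map)
  ultimately show ?thesis by (simp add: mem_dumont_132)
qed

lemma dumont_132_SucE:
  assumes "zs \<in> dumont_132 (Suc n)"
  obtains r xs ys where "r \<le> n" "zs = map ((+) r) xs @ Suc n # ys"
    "xs \<in> dumont_132 (n - r)" "ys \<in> dumont_132 r"
    "even r \<or> r = n" "odd n \<longleftrightarrow> r > 0"
proof -
  have zs: "set zs = {1..Suc n}" "distinct zs" "dumont zs" "avoids_132 zs"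
    using assms by (simp_all add: mem_dumont_132)
  then obtain us ys where split: "zs = us @ Suc n # ys"
    by (metis atLeastAtMost_iff le_refl less_eq_Suc_le split_list zero_less_Suc One_nat_def)
  have dist: "distinct us" "distinct ys" "set us \<inter> set ys = {}" "Suc n \<notin> set us \<union> set ys"
    using zs(2) by (auto simp: split)
  have un: "set us \<union> set ys = {1..n}"
  proof -
    have "set us \<union> set ys = {1..Suc n} - {Suc n}"
      using dist(4) unfolding zs(1)[symmetric] split by auto
    also have "\<dots> = {1..n}" by auto
    finally show ?thesis .
  qed
  then have less: "\<forall>x\<in>set us. x < Suc n" "\<forall>x\<in>set ys. x < Suc n"
    by (metis UnI1 UnI2 atLeastAtMost_iff le_imp_less_Suc)+
  have av: "avoids_132 us" "avoids_132 ys" "\<forall>a\<in>set us. \<forall>b\<in>set ys. b \<le> a"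
    using zs(4) less by (simp_all add: split avoids_132_append_greater)
  have du: "dumont us" "dumont (Suc n # ys)"
    using zs(3) less by (simp_all add: split dumont_append_greater)
  define r where "r = card (set ys)"
  \<comment> \<open>Avoidance gives only a weak inequality between the blocks; disjointness makes it
    strict.\<close>
  have sets: "set ys = {1..r}" "set us = {Suc r..n}"
    unfolding r_def using interval_split_below[OF un] av(3) dist(3)
    by (metis disjoint_iff le_neq_implies_less)+
  have "r \<le> n"
    unfolding r_def using card_mono[of "{1..n}" "set ys"] un
    by (metis card_atLeastAtMost diff_Suc_1 finite_atLeastAtMost sup_ge2)
  have ys: "odd n \<longleftrightarrow> ys \<noteq> []" "dumont ys"
    using du(2) less(2) by (auto simp: dumont_Cons_greater dumont_Nil split: if_splits)
  have r: "even r \<or> r = n"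
  proof (rule disjCI)
    assume "r \<noteq> n"
    \<comment> \<open>Now \<open>us\<close> is nonempty with least entry
      \<open>Suc r\<close>.\<close>
    then have "odd (Suc r)"
      using du(1) sets(2) \<open>r \<le> n\<close> by (intro dumont_least_odd[of us]) auto
    then show "even r" by simp
  qed
  define xs where "xs = map (\<lambda>u. u - r) us"
  \<comment> \<open>Truncated subtraction is undone here because every entry of \<open>us\<close>
    exceeds \<open>r\<close>.\<close>
  have us: "us = map ((+) r) xs"
    unfolding xs_def map_map by (rule map_idI[symmetric]) (auto simp: sets)
  have "(+) r ` set xs = (+) r ` {1..n - r}"
    using sets(2) \<open>r \<le> n\<close> by (simp add: us image_add_atLeastAtMost)
  then have "set xs = {1..n - r}"
    by (rule inj_image_eq_iff[THEN iffD1, rotated]) simp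
  moreover have "distinct xs" using dist(1) by (simp add: us distinct_map)
  moreover have "dumont xs"
  proof (cases "even r")
    case True
    then show ?thesis using du(1) by (simp add: us dumont_map_add)
  next
    case False
    then have "us = []" using r sets(2) by auto
    then show ?thesis by (simp add: us dumont_Nil)
  qed
  moreover have "avoids_132 xs" using av(1) by (simp add: us avoids_132_map_add)
  ultimately have "xs \<in> dumont_132 (n - r)" by (simp add: mem_dumont_132)
  moreover have "ys \<in> dumont_132 r"
    using sets(1) dist(2) ys(2) av(2) by (simp add: mem_dumont_132)
  moreover have "odd n \<longleftrightarrow> r > 0"
    using ys(1) by (simp add: r_def card_gt_0_iff)
  ultimately show thesis using that \<open>r \<le> n\<close> split us r by blast
qed

section \<open>Recurrences for the counts\<close>

lemma card_dumont_132_Suc: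
  "card (dumont_132 (Suc n)) =
    (\<Sum>r | r \<le> n \<and> (even r \<or> r = n) \<and> (odd n \<longleftrightarrow> r > 0).
      card (dumont_132 (n - r)) * card (dumont_132 r))"
proof -
  define I where "I = {r. r \<le> n \<and> (even r \<or> r = n) \<and> (odd n \<longleftrightarrow> r > 0)}"
  define S where "S = (SIGMA r:I. dumont_132 (n - r) \<times> dumont_132 r)"
  define f where "f = (\<lambda>(r, xs, ys). map ((+) r) xs @ Suc n # ys)"
  have "f ` S = dumont_132 (Suc n)"
  proof
    show "f ` S \<subseteq> dumont_132 (Suc n)"
      by (auto simp: f_def S_def I_def intro!: map_add_append_in_dumont_132)
    show "dumont_132 (Suc n) \<subseteq> f ` S"
    proof
      fix zs assume "zs \<in> dumont_132 (Suc n)"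
      then obtain r xs ys where "r \<le> n" "zs = map ((+) r) xs @ Suc n # ys"
        "xs \<in> dumont_132 (n - r)" "ys \<in> dumont_132 r"
        "even r \<or> r = n" "odd n \<longleftrightarrow> r > 0"
        by (rule dumont_132_SucE)
      then show "zs \<in> f ` S"
        by (intro image_eqI[of _ _ "(r, xs, ys)"]) (auto simp: f_def S_def I_def)
    qed
  qed
  moreover have "inj_on f S"
  proof (rule inj_onI)
    fix p q assume pq: "p \<in> S" "q \<in> S" "f p = f q"
    obtain r xs ys r' xs' ys' where p: "p = (r, xs, ys)" and q: "q = (r', xs', ys')"
      by (metis prod_cases3)
    have mem: "ys \<in> dumont_132 r" "ys' \<in> dumont_132 r'" "xs \<in> dumont_132 (n - r)"
        "xs' \<in> dumont_132 (n - r')" "r \<le> n" "r' \<le> n"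
      using pq by (auto simp: p q S_def I_def)
    \<comment> \<open>The maximum occurs once, so it marks the split; \<open>r\<close> is then
      recovered as the length of \<open>ys\<close>.\<close>
    then have "Suc n \<notin> set ys" "Suc n \<notin> set (map ((+) r) xs)"
      by (auto simp: mem_dumont_132)
    moreover have "map ((+) r) xs @ Suc n # ys = map ((+) r') xs' @ Suc n # ys'"
      using pq(3) by (simp add: p q f_def)
    ultimately have eq: "map ((+) r) xs = map ((+) r') xs'" "ys = ys'"
      by (simp_all add: append_Cons_eq_iff)
    moreover have "r = r'"
      using mem eq by (metis length_dumont_132)
    ultimately show "p = q" by (simp add: p q inj_map_eq_map)
  qed
  ultimately have "card (dumont_132 (Suc n)) = card S"
    by (metis card_image)
  also have "\<dots> = (\<Sum>r\<in>I. card (dumont_132 (n - r)) * card (dumont_132 r))"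
    unfolding S_def by (subst card_SigmaI) (auto simp: I_def finite_dumont_132 card_cartesian_product)
  finally show ?thesis by (simp add: I_def)
qed

lemma card_dumont_132_odd: "card (dumont_132 (Suc (2 * k))) = card (dumont_132 (2 * k))"
proof -
  \<comment> \<open>The odd maximum must come last, leaving an empty right block.\<close>
  have "{r. r \<le> 2 * k \<and> (even r \<or> r = 2 * k) \<and> (odd (2 * k) \<longleftrightarrow> r > 0)} = {0}"
    by auto
  then show ?thesis
    by (simp only: card_dumont_132_Suc) (simp add: dumont_132_0)
qed

lemma card_dumont_132_even:
  "card (dumont_132 (2 * Suc k)) =
    (\<Sum>j\<le>k. card (dumont_132 (2 * (k - j))) * card (dumont_132 (2 * j)))"
proof -
  let ?d = "\<lambda>n. card (dumont_132 n)" and ?n = "Suc (2 * k)"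
  \<comment> \<open>The right block is everything below the maximum, or has positive even
    length.\<close>
  have set_eq: "{r. r \<le> ?n \<and> (even r \<or> r = ?n) \<and> (odd ?n \<longleftrightarrow> r > 0)} =
      insert ?n ((\<lambda>j. 2 * j) ` {1..k})"
    by (auto elim!: evenE)
  have "?d (2 * Suc k) = (\<Sum>r\<in>insert ?n ((\<lambda>j. 2 * j) ` {1..k}). ?d (?n - r) * ?d r)"
    using card_dumont_132_Suc[of ?n] by (simp only: set_eq) simp
  also have "\<dots> = ?d 0 * ?d ?n + (\<Sum>j=1..k. ?d (?n - 2 * j) * ?d (2 * j))"
    by (subst sum.insert) (auto simp: sum.reindex inj_on_def, presburger)
  also have "(\<Sum>j=1..k. ?d (?n - 2 * j) * ?d (2 * j)) = (\<Sum>j=1..k. ?d (2 * (k - j)) * ?d (2 * j))"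
  proof (rule sum.cong)
    fix j assume "j \<in> {1..k}"
    then have "?n - 2 * j = Suc (2 * (k - j))" by auto
    then show "?d (?n - 2 * j) * ?d (2 * j) = ?d (2 * (k - j)) * ?d (2 * j)"
      by (simp only: card_dumont_132_odd)
  qed simp
  \<comment> \<open>The term for an empty left block equals \<open>?d (2 * k)\<close>, which is
    exactly the missing summand j = 0.\<close>
  also have "?d 0 * ?d ?n + \<dots> = (\<Sum>j\<le>k. ?d (2 * (k - j)) * ?d (2 * j))"
    by (simp add: card_dumont_132_odd dumont_132_0 atMost_atLeast0 sum.atLeast_Suc_atMost)
  finally show ?thesis .
qed

lemma card_dumont_132_double: "real (card (dumont_132 (2 * k))) = catalan k"
proof (induction k rule: less_induct)
  case (less k)
  show ?case
  proof (cases k)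
    case 0
    then show ?thesis by (simp add: dumont_132_0 catalan_def)
  next
    case (Suc m)
    have "real (card (dumont_132 (2 * Suc m))) = (\<Sum>j\<le>m. catalan (m - j) * catalan j)"
      unfolding card_dumont_132_even of_nat_sum of_nat_mult
      using less Suc by (intro sum.cong) auto
    then show ?thesis by (simp only: Suc catalan_convolution)
  qed
qed

lemma card_dumont_132: "real (card (dumont_132 n)) = catalan (n div 2)"
proof (cases "even n")
  case True
  then show ?thesis by (metis card_dumont_132_double dvd_mult_div_cancel)
next
  case False
  then obtain k where "n = Suc (2 * k)" by (metis oddE Suc_eq_plus1)
  then show ?thesis by (simp add: card_dumont_132_odd card_dumont_132_double)
qed

section \<open>Coefficients of the generating function\<close>

lemma fps_compose_X_square_nth:
  fixes a :: "'a :: comm_ring_1 fps"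
  shows "fps_nth (fps_compose a (fps_X ^ 2)) n = (if even n then fps_nth a (n div 2) else 0)"
proof -
  have "fps_nth (fps_compose a (fps_X ^ 2)) n = (\<Sum>i=0..n. if n = 2 * i then fps_nth a i else 0)"
    by (auto simp: fps_compose_nth fps_X_power_nth simp flip: power_mult intro!: sum.cong)
  also have "\<dots> = (if even n then fps_nth a (n div 2) else 0)"
  proof (cases "even n")
    case True
    \<comment> \<open>Solving the condition for \<open>i\<close> turns the sum into a delta sum,
      with \<open>n div 2\<close> in range.\<close>
    then have "(\<Sum>i=0..n. if n = 2 * i then fps_nth a i else 0) =
        (\<Sum>i=0..n. if n div 2 = i then fps_nth a i else 0)"
      by (intro sum.cong) auto
    with True show ?thesis by (simp add: sum.delta)
  qed (auto intro!: sum.neutral)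
  finally show ?thesis .
qed

theorem theorem2p2:
  shows "Abs_fps (\<lambda>n. real (card (dumont_132 n))) = (1 + fps_X) * fps_compose catalan_fps (fps_X ^ 2)
    \<and> (\<forall>n::nat. real (card (dumont_132 n)) = catalan (n div 2))"
proof
  show "Abs_fps (\<lambda>n. real (card (dumont_132 n))) = (1 + fps_X) * fps_compose catalan_fps (fps_X ^ 2)"
  proof (rule fps_ext)
    fix n
    show "fps_nth (Abs_fps (\<lambda>n. real (card (dumont_132 n)))) n =
        fps_nth ((1 + fps_X) * fps_compose catalan_fps (fps_X ^ 2)) n"
      \<comment> \<open>For positive n the coefficient of the product adds those of the composition
        at n and n - 1. Exactly one of these indices is even, and its half is
        \<open>n div 2\<close>.\<close>
      by (cases n)
        (auto simp: distrib_right fps_compose_X_square_nth catalan_fps_def card_dumont_132)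
  qed
qed (simp add: card_dumont_132)

end
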